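(* Let $f\in\mathcal{C}(SG)$ satisfy $0\le f(t)\le\tilde M$ for all $t\in SG$, let $N\ge 1$, and let $b\in\mathcal{C}(SG)$ satisfy $b(p_j)=f(p_j)$ for $j=1,2,3$. For $\omega\in I^N$ let $\alpha_\omega\in\mathcal{C}(SG)$ be such that $\|\alpha_\omega\|_\infty<1$ and, for all $\omega\in I^N$ and all $t\in SG$, $$\max\Big\{\frac{-m_\omega}{\tilde M-m_*},\ \frac{M_\omega-\tilde M}{M^*}\Big\}\le\alpha_\omega(t)\le\min\Big\{\frac{m_\omega}{M^*},\ \frac{\tilde M-M_\omega}{\tilde M-m_*}\Big\},$$ where $m_*=\min_{SG}b$, $M^*=\max_{SG}b$, $m_\omega=\min_{L_\omega(SG)}f$, $M_\omega=\max_{L_\omega(SG)}f$, and any quotient whose denominator is $0$ is omitted (imposes no condition). Then the corresponding $\alpha$-fractal function $f^\alpha\in\mathcal{C}(SG)$ satisfies $0\le f^\alpha(t)\le\tilde M$ for all $t\in SG$.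
   Context: Let $V_0=\{p_1,p_2,p_3\}$ be the vertices of an equilateral triangle in $\mathbb{R}^2$, $L_i(t)=\frac12(t+p_i)$ for $i\in I=\{1,2,3\}$, and let $SG$ (the Sierpiński gasket) be the unique nonempty compact set with $SG=\bigcup_{i=1}^3L_i(SG)$. For $\omega=\omega_1\cdots\omega_N\in I^N$ put $L_\omega=L_{\omega_1}\circ\cdots\circ L_{\omega_N}$. $\mathcal{C}(SG)$ is the space of continuous real-valued functions on $SG$ with the sup norm $\|\cdot\|_\infty$. Given $f,b$ and $(\alpha_\omega)_{\omega\in I^N}$, the $\alpha$-fractal function $f^\alpha$ is the unique continuous function on $SG$ satisfying, for all $\omega\in I^N$ and $t\in L_\omega(SG)$, $$f^\alpha(t)=f(t)+\alpha_\omega(L_\omega^{-1}(t))\,\big(f^\alpha-b\big)(L_\omega^{-1}(t)).$$ *)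

theory Defs
  imports "HOL-Analysis.Analysis" "HOL-Library.Numeral_Type" "HOL-Library.FuncSet"
begin

text \<open>The index set \<open>I = {1,2,3}\<close> is the three-element type \<open>3\<close> (in which \<open>3 = 0\<close>).\<close>

definition equilateral :: "(3 \<Rightarrow> real ^ 2) \<Rightarrow> bool" where
  "equilateral p \<longleftrightarrow> (\<exists>d>0. \<forall>i j. i \<noteq> j \<longrightarrow> dist (p i) (p j) = d)"

definition sg_map :: "(3 \<Rightarrow> real ^ 2) \<Rightarrow> 3 \<Rightarrow> real ^ 2 \<Rightarrow> real ^ 2" where
  "sg_map p i t = (1 / 2) *\<^sub>R (t + p i)"

definition SG :: "(3 \<Rightarrow> real ^ 2) \<Rightarrow> (real ^ 2) set" where
  "SG p = (THE S. S \<noteq> {} \<and> compact S \<and> S = (\<Union>i. sg_map p i ` S))"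

definition words :: "nat \<Rightarrow> 3 list set" where
  "words N = {\<omega>. length \<omega> = N}"

primrec word_map :: "(3 \<Rightarrow> real ^ 2) \<Rightarrow> 3 list \<Rightarrow> real ^ 2 \<Rightarrow> real ^ 2" where
  "word_map p [] = id"
| "word_map p (i # \<omega>) = sg_map p i \<circ> word_map p \<omega>"

definition sup_norm :: "'a set \<Rightarrow> ('a \<Rightarrow> real) \<Rightarrow> real" where
  "sup_norm S g = (SUP t\<in>S. \<bar>g t\<bar>)"

text \<open>
  Elements of \<open>C(SG)\<close> are total functions that are continuous on \<open>SG p\<close>; their values elsewhere
  are irrelevant. Only for the fractal function, so that the description below is unique,
  are the values outside \<open>SG p\<close> fixed (to \<open>undefined\<close>, by \<open>extensional\<close>).
\<close>

definition is_alpha_fractal ::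
  "(3 \<Rightarrow> real ^ 2) \<Rightarrow> nat \<Rightarrow> (real ^ 2 \<Rightarrow> real) \<Rightarrow> (real ^ 2 \<Rightarrow> real) \<Rightarrow>
   (3 list \<Rightarrow> real ^ 2 \<Rightarrow> real) \<Rightarrow> (real ^ 2 \<Rightarrow> real) \<Rightarrow> bool" where
  "is_alpha_fractal p N f b \<alpha> g \<longleftrightarrow>
     g \<in> extensional (SG p) \<and> continuous_on (SG p) g \<and>
     (\<forall>\<omega>\<in>words N. \<forall>t\<in>word_map p \<omega> ` SG p.
        g t = f t + \<alpha> \<omega> (inv (word_map p \<omega>) t) *
                      (g (inv (word_map p \<omega>) t) - b (inv (word_map p \<omega>) t)))"

definition alpha_fractal ::
  "(3 \<Rightarrow> real ^ 2) \<Rightarrow> nat \<Rightarrow> (real ^ 2 \<Rightarrow> real) \<Rightarrow> (real ^ 2 \<Rightarrow> real) \<Rightarrow>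
   (3 list \<Rightarrow> real ^ 2 \<Rightarrow> real) \<Rightarrow> real ^ 2 \<Rightarrow> real" where
  "alpha_fractal p N f b \<alpha> = (THE g. is_alpha_fractal p N f b \<alpha> g)"

text \<open>
  The two-sided bound on the scaling functions. A bound by a maximum or minimum of quotients is
  spelled out as a bound by each quotient, so that a quotient with denominator \<open>0\<close> can be omitted
  (HOL would evaluate it to \<open>0\<close>). The extrema are written as \<open>INF\<close> and \<open>SUP\<close>; they are attained,
  since the functions are continuous on nonempty compact sets.
\<close>

definition scaling_bounds ::
  "(3 \<Rightarrow> real ^ 2) \<Rightarrow> (real ^ 2 \<Rightarrow> real) \<Rightarrow> (real ^ 2 \<Rightarrow> real) \<Rightarrow> real \<Rightarrow> 3 list \<Rightarrow> real \<Rightarrow> bool" where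
  "scaling_bounds p f b M \<omega> a \<longleftrightarrow>
     (let m_star = (INF t\<in>SG p. b t); M_star = (SUP t\<in>SG p. b t);
          m_\<omega> = (INF t\<in>word_map p \<omega> ` SG p. f t); M_\<omega> = (SUP t\<in>word_map p \<omega> ` SG p. f t)
      in (M - m_star \<noteq> 0 \<longrightarrow> - m_\<omega> / (M - m_star) \<le> a \<and> a \<le> (M - M_\<omega>) / (M - m_star)) \<and>
         (M_star \<noteq> 0 \<longrightarrow> (M_\<omega> - M) / M_star \<le> a \<and> a \<le> m_\<omega> / M_star))"

end

theory Submission imports Defs begin

text \<open>
  Over each cell \<open>L\<^sub>\<omega>(SG)\<close>, the equation of the fractal function \<open>g\<close> applies the fibre map
  \<open>y \<mapsto> f (L\<^sub>\<omega> x) + \<alpha>\<^sub>\<omega> x * (y - b x)\<close> to the value \<open>y = g x\<close>. The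
  bounds on \<open>\<alpha>\<^sub>\<omega>\<close> imply that every fibre map sends the interval \<open>[0, M]\<close> into
  itself (\<open>scaling_bounds_preserve\<close>): \<open>y - b x\<close> lies between \<open>- M\<^sup>*\<close> and \<open>M - m\<^sub>*\<close>, so
  its product with \<open>\<alpha>\<^sub>\<omega> x\<close> lies between \<open>- m\<^sub>\<omega>\<close> and \<open>M - M\<^sub>\<omega>\<close>. Since the fibre maps shrink
  distances by \<open>\<bar>\<alpha>\<^sub>\<omega> x\<bar>\<close>, the distance of \<open>g (L\<^sub>\<omega> x)\<close> to \<open>[0, M]\<close> is at most \<open>\<bar>\<alpha>\<^sub>\<omega> x\<bar>\<close> times
  that of \<open>g x\<close>. A continuous function on the compact gasket that is contracted in this way
  vanishes, because its maximum is attained in some cell and is at most \<open>k < 1\<close> times itself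
  (\<open>contracted_eq_zero\<close>). Hence any solution takes values in \<open>[0, M]\<close>
  (\<open>solution_in_closed\<close>); applied to the difference of two solutions, the same principle gives
  uniqueness.

  The gasket and the fractal function are defined by unique existence, so both must be
  constructed. The gasket is the intersection of the iterated images of the triangle, which also
  shows that it lies in the triangle and contains the vertices. The fractal function is the
  uniform limit of the iterates of the Read-Bajraktarevic operator, the right-hand side of its
  equation. This operator is well defined and preserves continuity because distinct cells of the
  same level meet only in points that are images of vertices under both cell maps
  (\<open>word_map_meet\<close>), where the term with \<open>\<alpha>\<^sub>\<omega>\<close> drops out for a function that agrees with \<open>b\<close>
  at the vertices.
\<close>

section \<open>The gasket as an attractor\<close>

lemma dist_sg_map: "dist (sg_map p i x) (sg_map p i y) = dist x y / 2"
proof -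
  have "sg_map p i x - sg_map p i y = (1/2) *\<^sub>R (x - y)"
    by (simp add: sg_map_def algebra_simps)
  then show ?thesis by (simp add: dist_norm)
qed

lemma sg_map_eq_iff [simp]: "sg_map p i x = sg_map p i y \<longleftrightarrow> x = y"
  using dist_sg_map[of p i x y] by (metis dist_eq_0_iff divide_eq_0_iff zero_neq_numeral)

lemma sg_map_vertex [simp]: "sg_map p i (p i) = p i"
  by (simp add: sg_map_def flip: scaleR_2)

lemma continuous_on_sg_map: "continuous_on A (sg_map p i)"
  unfolding sg_map_def by (intro continuous_intros)

text \<open>
  The point of \<open>S\<close> farthest from \<open>T\<close> is the image of a point of \<open>S\<close> that is twice as far from
  \<open>T\<close>, so the greatest distance is zero.
\<close>

lemma attractor_subset:
  assumes "compact S" "S = (\<Union>i. sg_map p i ` S)"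
    and "compact T" "T \<noteq> {}" "T = (\<Union>i. sg_map p i ` T)"
  shows "S \<subseteq> T"
proof (cases "S = {}")
  case False
  have "continuous_on S (\<lambda>x. infdist x T)" by (intro continuous_intros)
  then obtain s where s: "s \<in> S" and s_max: "\<And>x. x \<in> S \<Longrightarrow> infdist x T \<le> infdist s T"
    using continuous_attains_sup[OF \<open>compact S\<close> False] by blast
  obtain i x where x: "x \<in> S" "s = sg_map p i x"
    using s assms(2) by blast
  obtain y where y: "y \<in> T" "infdist x T = dist x y"
    using infdist_attains_inf[of T x] assms(3,4) compact_imp_closed by blast
  have "infdist s T \<le> dist s (sg_map p i y)"
    using y(1) assms(5) by (intro infdist_le) blast
  also have "\<dots> = infdist x T / 2"
    by (simp add: x y dist_sg_map)
  also have "\<dots> \<le> infdist s T / 2"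
    using s_max[OF x(1)] by simp
  finally have zero: "infdist s T = 0"
    using infdist_nonneg[of s T] by linarith
  show ?thesis
  proof
    fix t assume "t \<in> S"
    then have "infdist t T = 0"
      using s_max[of t] zero infdist_nonneg[of t T] by linarith
    then show "t \<in> T"
      using assms(3,4) by (simp add: compact_imp_closed in_closed_iff_infdist_zero)
  qed
qed simp

text \<open>
  Each of the three maps moves a point halfway towards a vertex and so maps the triangle into
  itself. Hence the iterated images of the triangle decrease, and their intersection is an
  attractor.
\<close>

lemma attractor_exists:
  obtains S where "compact S" "S = (\<Union>i. sg_map p i ` S)"
    "range p \<subseteq> S" "S \<subseteq> convex hull (range p)"
proof -
  define \<Phi> where "\<Phi> = (\<lambda>A. \<Union>i. sg_map p i ` A)"
  define K where "K n = (\<Phi> ^^ n) (convex hull (range p))" for n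
  have K_Suc: "K (Suc n) = (\<Union>i. sg_map p i ` K n)" for n
    by (simp add: K_def \<Phi>_def)
  have mono: "\<Phi> A \<subseteq> \<Phi> B" if "A \<subseteq> B" for A B
    using that unfolding \<Phi>_def by blast
  have K0: "\<Phi> (K 0) \<subseteq> K 0"
  proof
    fix t assume "t \<in> \<Phi> (K 0)"
    then obtain i x where x: "x \<in> convex hull (range p)" "t = sg_map p i x"
      by (auto simp: \<Phi>_def K_def)
    have "(1/2) *\<^sub>R x + (1/2) *\<^sub>R p i \<in> convex hull (range p)"
      by (rule convexD[OF convex_convex_hull x(1)]) (auto intro: hull_inc)
    then show "t \<in> K 0"
      by (simp add: x K_def sg_map_def scaleR_right_distrib)
  qed
  have step: "K (Suc n) \<subseteq> K n" for n
  proof (induction n)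
    case 0
    show ?case using K0 by (simp add: K_def)
  next
    case (Suc n)
    then show ?case using mono[OF Suc] by (simp add: K_def)
  qed
  have anti: "K n \<subseteq> K m" if "m \<le> n" for m n
    using that by (rule lift_Suc_antimono_le[of K, OF step])
  have comp: "compact (K n)" for n
  proof (induction n)
    case 0
    then show ?case by (simp add: K_def compact_convex_hull finite_imp_compact)
  next
    case (Suc n)
    then show ?case
      unfolding K_Suc by (intro compact_UN compact_continuous_image continuous_on_sg_map) auto
  qed
  have vertex: "p i \<in> K n" for i n
  proof (induction n)
    case 0
    then show ?case by (simp add: K_def hull_inc)
  next
    case (Suc n)
    then show ?case unfolding K_Suc by (metis UN_I UNIV_I imageI sg_map_vertex)
  qed
  let ?S = "\<Inter>n. K n"
  have "?S = (\<Union>i. sg_map p i ` ?S)"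
  proof
    show "(\<Union>i. sg_map p i ` ?S) \<subseteq> ?S"
    proof clarify
      fix i x n
      assume "x \<in> ?S"
      then have "sg_map p i x \<in> K (Suc n)" by (auto simp: K_Suc)
      then show "sg_map p i x \<in> K n" using step by blast
    qed
    show "?S \<subseteq> (\<Union>i. sg_map p i ` ?S)"
    proof
      fix t assume t: "t \<in> ?S"
      \<comment> \<open>If each of the three maps failed to reach \<open>t\<close> from some stage, all would fail from
        the latest of these stages, since the stages decrease.\<close>
      have "\<exists>i. \<forall>n. t \<in> sg_map p i ` K n"
      proof (rule ccontr)
        assume "\<nexists>i. \<forall>n. t \<in> sg_map p i ` K n"
        then obtain n where n: "\<And>i. t \<notin> sg_map p i ` K (n i)" by metis
        define m where "m = Max (range n)"
        have "t \<in> K (Suc m)" using t by blast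
        then obtain i where "t \<in> sg_map p i ` K m" by (auto simp: K_Suc)
        moreover have "K m \<subseteq> K (n i)" by (rule anti) (simp add: m_def)
        ultimately show False using n[of i] by blast
      qed
      then obtain i where i: "\<And>n. t \<in> sg_map p i ` K n" by blast
      then obtain x where x: "t = sg_map p i x" by blast
      have "x \<in> K n" for n using i[of n] by (auto simp: x)
      then show "t \<in> (\<Union>i. sg_map p i ` ?S)" using x by blast
    qed
  qed
  moreover have "compact ?S"
    using comp by (intro compact_Inter) auto
  moreover have "?S \<subseteq> convex hull (range p)"
    using INF_lower[of 0 UNIV K] by (simp add: K_def)
  ultimately show thesis using that[of ?S] vertex by blast
qed

lemma
  shows compact_SG: "compact (SG p)"
    and SG_eq: "SG p = (\<Union>i. sg_map p i ` SG p)"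
    and vertex_in_SG: "p i \<in> SG p"
    and SG_subset_hull: "SG p \<subseteq> convex hull (range p)"
proof -
  obtain S where S: "compact S" "S = (\<Union>i. sg_map p i ` S)"
    "range p \<subseteq> S" "S \<subseteq> convex hull (range p)"
    by (rule attractor_exists)
  have "S \<noteq> {}" using S(3) by blast
  have "SG p = S"
    unfolding SG_def
  proof (rule the_equality)
    show "S \<noteq> {} \<and> compact S \<and> S = (\<Union>i. sg_map p i ` S)"
      using S \<open>S \<noteq> {}\<close> by blast
    show "T = S" if "T \<noteq> {} \<and> compact T \<and> T = (\<Union>i. sg_map p i ` T)" for T
      using attractor_subset[of S p T] attractor_subset[of T p S] that S(1,2) \<open>S \<noteq> {}\<close>
      by blast
  qed
  then show "compact (SG p)" "SG p = (\<Union>i. sg_map p i ` SG p)" "p i \<in> SG p"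
    "SG p \<subseteq> convex hull (range p)"
    using S by auto
qed

section \<open>Cells of the gasket\<close>

lemma inj_word_map: "inj (word_map p \<omega>)"
  by (induction \<omega>) (auto simp: inj_def)

lemma continuous_on_word_map: "continuous_on A (word_map p \<omega>)"
proof (induction \<omega> arbitrary: A)
  case (Cons i \<omega>)
  then show ?case
    using continuous_on_compose[OF Cons continuous_on_sg_map] by simp
qed (simp add: id_def)

lemma word_map_in_SG: "x \<in> SG p \<Longrightarrow> word_map p \<omega> x \<in> SG p"
proof (induction \<omega>)
  case (Cons i \<omega>)
  then show ?case by (subst SG_eq) auto
qed simp

lemma SG_words: "SG p = (\<Union>\<omega>\<in>words N. word_map p \<omega> ` SG p)"
proof
  show "(\<Union>\<omega>\<in>words N. word_map p \<omega> ` SG p) \<subseteq> SG p"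
    using word_map_in_SG by blast
  show "SG p \<subseteq> (\<Union>\<omega>\<in>words N. word_map p \<omega> ` SG p)"
  proof (induction N)
    case 0
    then show ?case by (simp add: words_def)
  next
    case (Suc N)
    show ?case
    proof
      fix t assume "t \<in> SG p"
      then obtain i s where s: "s \<in> SG p" "t = sg_map p i s"
        using SG_eq[of p] by blast
      then obtain \<omega> x where "\<omega> \<in> words N" "x \<in> SG p" "s = word_map p \<omega> x"
        using Suc by blast
      then have "i # \<omega> \<in> words (Suc N)" "t = word_map p (i # \<omega>) x" "x \<in> SG p"
        by (simp_all add: words_def s)
      then show "t \<in> (\<Union>\<omega>\<in>words (Suc N). word_map p \<omega> ` SG p)" by blast
    qed
  qed
qed

lemma word_map_replicate_vertex: "word_map p (replicate n i) (p i) = p i"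
  by (induction n) auto

text \<open>
  For fixed \<open>i\<close> and \<open>j\<close>, the inequality defines a convex set of points \<open>t\<close>, so it is enough to
  check it at the vertices. If \<open>d > 0\<close>, it makes \<open>p i\<close> the only point of the triangle that is farthest
  in the direction \<open>p i - p j\<close>.
\<close>

lemma norm_le_inner_vertex:
  assumes d: "\<And>i j. i \<noteq> j \<Longrightarrow> dist (p i) (p j) = d"
    and "i \<noteq> j" and t: "t \<in> convex hull (range p)"
  shows "d * norm (p i - t) \<le> 2 * ((p i - t) \<bullet> (p i - p j))"
proof -
  let ?H = "{t. d * norm (p i - t) \<le> 2 * ((p i - t) \<bullet> (p i - p j))}"
  have d0: "d \<ge> 0" using d[OF \<open>i \<noteq> j\<close>] zero_le_dist by metis
  have "range p \<subseteq> ?H"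
  proof clarify
    fix k
    have "2 * ((p i - p k) \<bullet> (p i - p j)) =
        (dist (p i) (p k))\<^sup>2 + (dist (p i) (p j))\<^sup>2 - (dist (p j) (p k))\<^sup>2"
      by (simp add: dot_norm_neg dist_norm)
    then show "d * norm (p i - p k) \<le> 2 * ((p i - p k) \<bullet> (p i - p j))"
      using d[of i k] d[of i j] d[of j k] \<open>i \<noteq> j\<close>
      by (cases "k = i"; cases "k = j") (simp_all add: dist_norm power2_eq_square)
  qed
  moreover have "convex ?H"
  proof (rule convexI, clarify)
    fix x y and u v :: real
    assume x: "d * norm (p i - x) \<le> 2 * ((p i - x) \<bullet> (p i - p j))"
      and y: "d * norm (p i - y) \<le> 2 * ((p i - y) \<bullet> (p i - p j))"
      and uv: "0 \<le> u" "0 \<le> v" "u + v = 1"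
    have split: "p i - (u *\<^sub>R x + v *\<^sub>R y) = u *\<^sub>R (p i - x) + v *\<^sub>R (p i - y)"
      using uv(3) by (simp add: algebra_simps flip: scaleR_add_left)
    have "norm (p i - (u *\<^sub>R x + v *\<^sub>R y)) \<le> u * norm (p i - x) + v * norm (p i - y)"
      unfolding split using norm_triangle_ineq[of "u *\<^sub>R (p i - x)" "v *\<^sub>R (p i - y)"] uv by simp
    from mult_left_mono[OF this d0]
    have "d * norm (p i - (u *\<^sub>R x + v *\<^sub>R y)) \<le>
        u * (d * norm (p i - x)) + v * (d * norm (p i - y))"
      by (simp add: algebra_simps)
    also have "\<dots> \<le> u * (2 * ((p i - x) \<bullet> (p i - p j))) + v * (2 * ((p i - y) \<bullet> (p i - p j)))"
      using x y uv by (intro add_mono mult_left_mono) auto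
    also have "\<dots> = 2 * ((p i - (u *\<^sub>R x + v *\<^sub>R y)) \<bullet> (p i - p j))"
      unfolding split by (simp add: algebra_simps)
    finally show "d * norm (p i - (u *\<^sub>R x + v *\<^sub>R y)) \<le>
      2 * ((p i - (u *\<^sub>R x + v *\<^sub>R y)) \<bullet> (p i - p j))" .
  qed
  ultimately show ?thesis using t hull_minimal[of "range p" ?H convex] by blast
qed

text \<open>
  Here \<open>p j - x = p i - y\<close>. The preceding estimate at \<open>p i\<close> and at \<open>p j\<close> bounds the norm of
  this vector by its inner products with two opposite vectors, so the vector is zero.
\<close>

lemma sg_map_meet:
  assumes "equilateral p" "i \<noteq> j"
    and x: "x \<in> convex hull (range p)" and y: "y \<in> convex hull (range p)"
    and eq: "sg_map p i x = sg_map p j y"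
  shows "x = p j \<and> y = p i"
proof -
  obtain d where d: "d > 0" "\<And>i j. i \<noteq> j \<Longrightarrow> dist (p i) (p j) = d"
    using \<open>equilateral p\<close> unfolding equilateral_def by blast
  have "x + p i = y + p j"
    using eq by (simp add: sg_map_def)
  then have diff: "p j - x = p i - y"
    by (simp add: algebra_simps)
  have "d * norm (p i - y) \<le> 2 * ((p i - y) \<bullet> (p i - p j))"
    using norm_le_inner_vertex[OF d(2) \<open>i \<noteq> j\<close> y] by simp
  moreover have "d * norm (p i - y) \<le> 2 * ((p i - y) \<bullet> (p j - p i))"
    using norm_le_inner_vertex[OF d(2) _ x, of j i] \<open>i \<noteq> j\<close> by (simp add: diff)
  ultimately have "d * norm (p i - y) \<le> 0"
    by (simp add: inner_diff_right)
  then have "p i - y = 0"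
    using \<open>d > 0\<close> by (simp add: mult_le_0_iff)
  then show ?thesis using diff by simp
qed

lemma sg_map_eq_vertexD:
  assumes "equilateral p" "x \<in> convex hull (range p)" "sg_map p i x = p j"
  shows "x = p j"
proof (cases "i = j")
  case True
  then show ?thesis using assms(3) by (metis sg_map_eq_iff sg_map_vertex)
next
  case False
  then show ?thesis
    using sg_map_meet[of p i j x "p j"] assms by (simp add: hull_inc)
qed

lemma word_map_eq_vertexD:
  assumes "equilateral p" "x \<in> SG p" "word_map p \<omega> x = p j"
  shows "x = p j"
  using assms(3)
proof (induction \<omega>)
  case (Cons i \<omega>)
  have "word_map p \<omega> x \<in> convex hull (range p)"
    using word_map_in_SG[OF assms(2)] SG_subset_hull by blast
  then have "word_map p \<omega> x = p j"
    using sg_map_eq_vertexD[OF assms(1)] Cons.prems by simp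
  then show ?case by (rule Cons.IH)
qed simp

text \<open>
  The first letter in which the words differ leads to two distinct half-size triangles. These meet
  only in a point that is the image of a vertex on either side, so the tails of the words send
  \<open>x\<close> and \<open>y\<close> to vertices. The only preimage of a vertex under a word is that vertex itself.
\<close>

lemma word_map_meet:
  assumes "equilateral p" "x \<in> SG p" "y \<in> SG p"
    and "length \<omega> = length \<omega>'" "word_map p \<omega> x = word_map p \<omega>' y"
  shows "(\<omega> = \<omega>' \<and> x = y) \<or> (x \<in> range p \<and> y \<in> range p)"
  using assms(4,5)
proof (induction \<omega> \<omega>' rule: list_induct2)
  case (Cons i \<omega> j \<omega>')
  show ?case
  proof (cases "i = j")
    case True
    then show ?thesis using Cons by auto
  next
    case False
    have "word_map p \<omega> x \<in> convex hull (range p)" "word_map p \<omega>' y \<in> convex hull (range p)"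
      using word_map_in_SG assms(2,3) SG_subset_hull by blast+
    then have "word_map p \<omega> x = p j" "word_map p \<omega>' y = p i"
      using sg_map_meet[OF assms(1) False] Cons.prems by simp_all
    then show ?thesis using word_map_eq_vertexD[OF assms(1)] assms(2,3) by blast
  qed
qed simp

section \<open>Fractal functions over a system of cells\<close>

lemma uniform_limit_geometric:
  fixes F :: "nat \<Rightarrow> 'a \<Rightarrow> 'b::banach"
  assumes "0 \<le> k" "k < 1" "\<And>n x. x \<in> S \<Longrightarrow> norm (F (Suc n) x - F n x) \<le> C * k ^ n"
  obtains g where "uniform_limit S F g sequentially"
proof -
  have "summable (\<lambda>n. C * k ^ n)"
    using assms(1,2) by (intro summable_mult summable_geometric) simp
  then have "uniform_limit S (\<lambda>n x. \<Sum>i<n. F (Suc i) x - F i x)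
      (\<lambda>x. \<Sum>i. F (Suc i) x - F i x) sequentially"
    using assms(3) by (intro Weierstrass_m_test)
  moreover have "(\<Sum>i<n. F (Suc i) x - F i x) = F n x - F 0 x" for n x
    by (rule sum_lessThan_telescope[of "\<lambda>i. F i x"])
  ultimately have "uniform_limit S (\<lambda>n x. F 0 x + (F n x - F 0 x))
      (\<lambda>x. F 0 x + (\<Sum>i. F (Suc i) x - F i x)) sequentially"
    by (intro uniform_limit_add uniform_limit_const) simp
  then show thesis using that by simp
qed

text \<open>
  The construction of the fractal function uses only the combinatorics of the cells \<open>\<phi> w ` S\<close>:
  they cover \<open>S\<close>, they overlap only in images of boundary points, and every boundary point is
  the image of a boundary point. For the gasket, \<open>V\<close> is the set of the three vertices and \<open>W\<close> is
  the set of words of length \<open>N\<close>.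
\<close>

locale cell_system =
  fixes S V :: "'a::metric_space set" and W :: "'w set" and \<phi> :: "'w \<Rightarrow> 'a \<Rightarrow> 'a"
    and f b :: "'a \<Rightarrow> real" and \<alpha> :: "'w \<Rightarrow> 'a \<Rightarrow> real" and k :: real
  assumes compact: "compact S"
    and finite_index: "finite W"
    and continuous_map: "\<And>w. w \<in> W \<Longrightarrow> continuous_on S (\<phi> w)"
    and cover: "S = (\<Union>w\<in>W. \<phi> w ` S)"
    and meet: "\<And>w w' x y. \<lbrakk>w \<in> W; w' \<in> W; x \<in> S; y \<in> S; \<phi> w x = \<phi> w' y\<rbrakk>
                \<Longrightarrow> (w = w' \<and> x = y) \<or> (x \<in> V \<and> y \<in> V)"
    and boundary_subset: "V \<subseteq> S"
    and boundary_image: "V \<subseteq> (\<Union>w\<in>W. \<phi> w ` V)"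
    and inj_map: "\<And>w. w \<in> W \<Longrightarrow> inj_on (\<phi> w) S"
    and continuous_f: "continuous_on S f"
    and continuous_b: "continuous_on S b"
    and b_eq_f: "\<And>v. v \<in> V \<Longrightarrow> b v = f v"
    and continuous_scaling: "\<And>w. w \<in> W \<Longrightarrow> continuous_on S (\<alpha> w)"
    and scaling_le: "\<And>w x. \<lbrakk>w \<in> W; x \<in> S\<rbrakk> \<Longrightarrow> \<bar>\<alpha> w x\<bar> \<le> k"
    and contraction: "0 \<le> k" "k < 1"
begin

definition solution :: "('a \<Rightarrow> real) \<Rightarrow> bool" where
  "solution g \<longleftrightarrow> continuous_on S g \<and>
     (\<forall>w\<in>W. \<forall>x\<in>S. g (\<phi> w x) = f (\<phi> w x) + \<alpha> w x * (g x - b x))"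

lemma map_in: "w \<in> W \<Longrightarrow> x \<in> S \<Longrightarrow> \<phi> w x \<in> S"
  using cover by blast

lemma cellE:
  assumes "t \<in> S"
  obtains w x where "w \<in> W" "x \<in> S" "t = \<phi> w x"
  using assms cover by blast

text \<open>
  The maximum of \<open>\<psi>\<close> is attained at some \<open>\<phi> w x\<close>, hence is at most \<open>k\<close> times the value at \<open>x\<close>,
  and so at most \<open>k\<close> times itself.
\<close>

lemma contracted_eq_zero:
  fixes \<psi> :: "'a \<Rightarrow> real"
  assumes "continuous_on S \<psi>" "\<And>x. x \<in> S \<Longrightarrow> 0 \<le> \<psi> x"
    and le: "\<And>w x. w \<in> W \<Longrightarrow> x \<in> S \<Longrightarrow> \<psi> (\<phi> w x) \<le> \<bar>\<alpha> w x\<bar> * \<psi> x"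
    and "t \<in> S"
  shows "\<psi> t = 0"
proof -
  obtain s where s: "s \<in> S" and s_max: "\<And>x. x \<in> S \<Longrightarrow> \<psi> x \<le> \<psi> s"
    using continuous_attains_sup[OF compact _ assms(1)] \<open>t \<in> S\<close> by blast
  obtain w x where w: "w \<in> W" "x \<in> S" "s = \<phi> w x"
    using s by (rule cellE)
  have "\<psi> s \<le> \<bar>\<alpha> w x\<bar> * \<psi> x"
    using le w by simp
  also have "\<dots> \<le> k * \<psi> s"
    using w s_max scaling_le contraction assms(2) by (intro mult_mono) auto
  finally have "(1 - k) * \<psi> s \<le> 0"
    by (simp add: algebra_simps)
  then have "\<psi> s \<le> 0"
    using contraction by (simp add: mult_le_0_iff)
  then show ?thesis
    using s_max[OF \<open>t \<in> S\<close>] assms(2)[OF \<open>t \<in> S\<close>] by linarith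
qed

lemma solution_unique:
  assumes g: "solution g" and h: "solution h" and "t \<in> S"
  shows "g t = h t"
proof -
  have "\<bar>g t - h t\<bar> = 0"
  proof (rule contracted_eq_zero[OF _ _ _ \<open>t \<in> S\<close>])
    show "continuous_on S (\<lambda>t. \<bar>g t - h t\<bar>)"
      using g h unfolding solution_def by (intro continuous_intros) auto
    show "\<bar>g (\<phi> w x) - h (\<phi> w x)\<bar> \<le> \<bar>\<alpha> w x\<bar> * \<bar>g x - h x\<bar>" if "w \<in> W" "x \<in> S" for w x
    proof -
      have "g (\<phi> w x) - h (\<phi> w x) = \<alpha> w x * (g x - h x)"
        using g h that by (simp add: solution_def flip: right_diff_distrib)
      then show ?thesis by (simp add: abs_mult)
    qed
  qed simp
  then show ?thesis by simp
qed

text \<open>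
  A nearest point \<open>y\<close> of \<open>C\<close> to \<open>g x\<close> is sent into \<open>C\<close> by the fibre map over \<open>x\<close>, at distance
  \<open>\<bar>\<alpha> w x\<bar> * \<bar>g x - y\<bar>\<close> from \<open>g (\<phi> w x)\<close>. Thus the distance of \<open>g\<close> to \<open>C\<close> is
  contracted.
\<close>

lemma solution_in_closed:
  assumes g: "solution g" and "closed C" "C \<noteq> {}"
    and C: "\<And>w x y. \<lbrakk>w \<in> W; x \<in> S; y \<in> C\<rbrakk> \<Longrightarrow> f (\<phi> w x) + \<alpha> w x * (y - b x) \<in> C"
    and "t \<in> S"
  shows "g t \<in> C"
proof -
  have "infdist (g t) C = 0"
  proof (rule contracted_eq_zero[OF _ _ _ \<open>t \<in> S\<close>])
    show "continuous_on S (\<lambda>t. infdist (g t) C)"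
      using g unfolding solution_def by (intro continuous_intros) auto
    show "infdist (g (\<phi> w x)) C \<le> \<bar>\<alpha> w x\<bar> * infdist (g x) C" if wx: "w \<in> W" "x \<in> S" for w x
    proof -
      obtain y where y: "y \<in> C" "infdist (g x) C = dist (g x) y"
        using infdist_attains_inf[OF \<open>closed C\<close> \<open>C \<noteq> {}\<close>] by blast
      let ?z = "f (\<phi> w x) + \<alpha> w x * (y - b x)"
      have "infdist (g (\<phi> w x)) C \<le> dist (g (\<phi> w x)) ?z"
        by (rule infdist_le) (rule C[OF wx y(1)])
      also have "g (\<phi> w x) - ?z = \<alpha> w x * (g x - y)"
        using g wx by (simp add: solution_def algebra_simps)
      then have "dist (g (\<phi> w x)) ?z = \<bar>\<alpha> w x\<bar> * infdist (g x) C"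
        by (simp add: dist_real_def abs_mult y)
      finally show ?thesis .
    qed
  qed (rule infdist_nonneg)
  then show ?thesis
    using assms(2,3) by (simp add: in_closed_iff_infdist_zero)
qed

text \<open>
  The Read-Bajraktarevic operator. A point of several cells has several addresses \<open>(w, x)\<close>, of
  which one is chosen; \<open>rb_map\<close> shows that the choice does not matter for the functions that agree
  with \<open>b\<close> on \<open>V\<close>.
\<close>

definition rb :: "('a \<Rightarrow> real) \<Rightarrow> 'a \<Rightarrow> real" where
  "rb g t = (case SOME (w, x). w \<in> W \<and> x \<in> S \<and> \<phi> w x = t of
     (w, x) \<Rightarrow> f t + \<alpha> w x * (g x - b x))"

text \<open>
  Two addresses \<open>(w, x)\<close> of one point differ only if their points \<open>x\<close> are in \<open>V\<close>, and there the
  factor \<open>g x - b x\<close> is zero.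
\<close>

lemma rb_map:
  assumes g: "\<And>v. v \<in> V \<Longrightarrow> g v = b v" and w: "w \<in> W" "x \<in> S"
  shows "rb g (\<phi> w x) = f (\<phi> w x) + \<alpha> w x * (g x - b x)"
proof -
  obtain w' x' where some: "(SOME (w', x'). w' \<in> W \<and> x' \<in> S \<and> \<phi> w' x' = \<phi> w x) = (w', x')"
    by fastforce
  have "case (w', x') of (w', x') \<Rightarrow> w' \<in> W \<and> x' \<in> S \<and> \<phi> w' x' = \<phi> w x"
    unfolding some[symmetric] by (rule someI[of _ "(w, x)"]) (simp add: w)
  then have "(w' = w \<and> x' = x) \<or> (x' \<in> V \<and> x \<in> V)"
    using meet w by auto
  then show ?thesis
    unfolding rb_def some using g by auto
qed

lemma rb_boundary:
  assumes g: "\<And>v. v \<in> V \<Longrightarrow> g v = b v" and "v \<in> V"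
  shows "rb g v = b v"
proof -
  obtain w u where u: "w \<in> W" "u \<in> V" "v = \<phi> w u"
    using boundary_image \<open>v \<in> V\<close> by blast
  then have "rb g v = f v"
    using rb_map[of g w u] g boundary_subset by auto
  then show ?thesis using b_eq_f \<open>v \<in> V\<close> by simp
qed

text \<open>
  On each of the finitely many closed cells \<open>rb g\<close> is a composition of continuous functions; the
  inverse of a cell map is continuous since \<open>S\<close> is compact.
\<close>

lemma continuous_on_rb:
  assumes g: "\<And>v. v \<in> V \<Longrightarrow> g v = b v" and cont: "continuous_on S g"
  shows "continuous_on S (rb g)"
proof -
  have piece: "continuous_on (\<phi> w ` S) (rb g)" if w: "w \<in> W" for w
  proof -
    let ?inv = "inv_into S (\<phi> w)"
    have inv: "continuous_on (\<phi> w ` S) ?inv"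
      using inj_map[OF w] by (intro continuous_on_inv continuous_map w compact) simp
    have img: "?inv ` \<phi> w ` S \<subseteq> S"
      using inj_map[OF w] by auto
    have "continuous_on S (\<lambda>x. \<alpha> w x * (g x - b x))"
      using w by (intro continuous_on_mult continuous_on_diff continuous_scaling cont continuous_b)
    from continuous_on_compose2[OF this inv img]
    have "continuous_on (\<phi> w ` S) (\<lambda>t. \<alpha> w (?inv t) * (g (?inv t) - b (?inv t)))" .
    moreover have "continuous_on (\<phi> w ` S) f"
      using map_in[OF w] by (intro continuous_on_subset[OF continuous_f]) blast
    ultimately have "continuous_on (\<phi> w ` S)
        (\<lambda>t. f t + \<alpha> w (?inv t) * (g (?inv t) - b (?inv t)))"
      by (intro continuous_on_add)
    moreover have "rb g t = f t + \<alpha> w (?inv t) * (g (?inv t) - b (?inv t))"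
      if "t \<in> \<phi> w ` S" for t
      using that rb_map[OF g w] inj_map[OF w] by auto
    ultimately show ?thesis by (simp cong: continuous_on_cong)
  qed
  have "continuous_on (\<Union>w\<in>W. \<phi> w ` S) (rb g)"
    using finite_index piece compact continuous_map
    by (intro continuous_on_closed_Union) (auto intro: compact_imp_closed compact_continuous_image)
  then show ?thesis using cover by simp
qed

text \<open>
  Picard iteration from \<open>f\<close>, which agrees with \<open>b\<close> on \<open>V\<close>. The operator preserves this agreement,
  so it acts on every iterate cell by cell and shrinks the difference of consecutive iterates by
  \<open>k\<close>.
\<close>

lemma solution_exists:
  obtains g where "solution g"
proof -
  define F where "F n = (rb ^^ n) f" for n
  have F_Suc: "F (Suc n) = rb (F n)" for n by (simp add: F_def)
  have F_boundary: "F n v = b v" if "v \<in> V" for n v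
    using that
  proof (induction n arbitrary: v)
    case 0
    then show ?case by (simp add: F_def b_eq_f)
  next
    case (Suc n)
    then show ?case by (simp add: F_Suc rb_boundary)
  qed
  have F_cont: "continuous_on S (F n)" for n
  proof (induction n)
    case 0
    then show ?case by (simp add: F_def continuous_f)
  next
    case (Suc n)
    then show ?case by (simp add: F_Suc continuous_on_rb F_boundary)
  qed
  have F_map: "F (Suc n) (\<phi> w x) = f (\<phi> w x) + \<alpha> w x * (F n x - b x)"
    if "w \<in> W" "x \<in> S" for n w x
    unfolding F_Suc using F_boundary that by (rule rb_map)
  have "continuous_on S (\<lambda>x. F 1 x - F 0 x)"
    using F_cont by (intro continuous_intros)
  then have "bounded ((\<lambda>x. F 1 x - F 0 x) ` S)"
    using compact by (intro compact_imp_bounded compact_continuous_image)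
  then obtain C where C: "\<And>x. x \<in> S \<Longrightarrow> norm (F 1 x - F 0 x) \<le> C"
    unfolding bounded_iff by blast
  have step: "norm (F (Suc n) t - F n t) \<le> C * k ^ n" if "t \<in> S" for n t
    using that
  proof (induction n arbitrary: t)
    case 0
    then show ?case using C by simp
  next
    case (Suc n)
    obtain w x where w: "w \<in> W" "x \<in> S" "t = \<phi> w x"
      using \<open>t \<in> S\<close> by (rule cellE)
    have "F (Suc (Suc n)) t - F (Suc n) t = \<alpha> w x * (F (Suc n) x - F n x)"
      by (simp add: F_map w flip: right_diff_distrib)
    then have "norm (F (Suc (Suc n)) t - F (Suc n) t) = \<bar>\<alpha> w x\<bar> * norm (F (Suc n) x - F n x)"
      by (simp add: abs_mult)
    also have "\<dots> \<le> k * (C * k ^ n)"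
      using Suc.IH scaling_le contraction w by (intro mult_mono) auto
    finally show ?case by (simp add: algebra_simps)
  qed
  obtain g where g: "uniform_limit S F g sequentially"
    using uniform_limit_geometric[OF contraction] step by blast
  have "continuous_on S g"
    using uniform_limit_theorem[OF _ g] F_cont by simp
  moreover have "g (\<phi> w x) = f (\<phi> w x) + \<alpha> w x * (g x - b x)" if "w \<in> W" "x \<in> S" for w x
  proof (rule LIMSEQ_unique)
    have lim: "(\<lambda>n. F n t) \<longlonglongrightarrow> g t" if "t \<in> S" for t
      using tendsto_uniform_limitI[OF g that] .
    show "(\<lambda>n. F (Suc n) (\<phi> w x)) \<longlonglongrightarrow> g (\<phi> w x)"
      by (intro LIMSEQ_Suc lim map_in that)
    show "(\<lambda>n. F (Suc n) (\<phi> w x)) \<longlonglongrightarrow> f (\<phi> w x) + \<alpha> w x * (g x - b x)"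
      unfolding F_map[OF that] using lim that by (intro tendsto_intros)
  qed
  ultimately show thesis using that unfolding solution_def by blast
qed

end

section \<open>Positivity and the upper bound\<close>

text \<open>
  At a vertex \<open>b\<close> agrees with \<open>f\<close>, hence \<open>m_star \<le> M\<close> and \<open>0 \<le> M_star\<close>. Multiplying out the
  quotients therefore preserves the inequalities. If a denominator is zero, the multiplied
  inequality still holds, as it then says \<open>0 \<le> m_\<omega>\<close> or \<open>M_\<omega> \<le> M\<close>. For \<open>a \<ge> 0\<close> the
  product \<open>a * (y - b x)\<close> is bounded below by \<open>- a * M_star\<close> and above by \<open>a * (M - m_star)\<close>;
  for \<open>a < 0\<close> these two bounds change roles.
\<close>

lemma scaling_bounds_preserve:
  assumes bounds: "scaling_bounds p f b M \<omega> a"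
    and cont: "continuous_on (SG p) f" "continuous_on (SG p) b"
    and f: "\<And>t. t \<in> SG p \<Longrightarrow> 0 \<le> f t \<and> f t \<le> M"
    and b: "b (p j) = f (p j)"
    and x: "x \<in> SG p" and y: "0 \<le> y" "y \<le> M"
  shows "0 \<le> f (word_map p \<omega> x) + a * (y - b x)" "f (word_map p \<omega> x) + a * (y - b x) \<le> M"
proof -
  let ?cell = "word_map p \<omega> ` SG p"
  define m_star M_star m_\<omega> M_\<omega> where
    "m_star = (INF t\<in>SG p. b t)" and "M_star = (SUP t\<in>SG p. b t)" and
    "m_\<omega> = (INF t\<in>?cell. f t)" and "M_\<omega> = (SUP t\<in>?cell. f t)"
  note defs = m_star_def M_star_def m_\<omega>_def M_\<omega>_def
  have "bounded (b ` SG p)" "bounded (f ` SG p)"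
    using cont compact_SG by (auto intro: compact_imp_bounded compact_continuous_image)
  moreover have cell: "?cell \<subseteq> SG p"
    using word_map_in_SG by blast
  ultimately have "bounded (b ` SG p)" "bounded (f ` ?cell)"
    by (blast intro: bounded_subset image_mono)+
  then have bdd: "bdd_above (b ` SG p)" "bdd_below (b ` SG p)"
    "bdd_above (f ` ?cell)" "bdd_below (f ` ?cell)"
    by (auto intro: bounded_imp_bdd_above bounded_imp_bdd_below)
  have b_range: "m_star \<le> b t \<and> b t \<le> M_star" if "t \<in> SG p" for t
    using that bdd by (auto simp: defs intro: cINF_lower cSUP_upper)
  have f_range: "m_\<omega> \<le> f (word_map p \<omega> x)" "f (word_map p \<omega> x) \<le> M_\<omega>"
    using x bdd by (auto simp: defs intro: cINF_lower cSUP_upper)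
  have f_hull: "0 \<le> m_\<omega>" "M_\<omega> \<le> M"
    using x f cell by (auto simp: defs intro!: cINF_greatest cSUP_least)
  have signs: "m_star \<le> M" "0 \<le> M_star"
    using b_range[OF vertex_in_SG, of j] f[OF vertex_in_SG, of j] b by auto
  have quot: "M - m_star \<noteq> 0 \<longrightarrow> - m_\<omega> / (M - m_star) \<le> a \<and> a \<le> (M - M_\<omega>) / (M - m_star)"
    "M_star \<noteq> 0 \<longrightarrow> (M_\<omega> - M) / M_star \<le> a \<and> a \<le> m_\<omega> / M_star"
    using bounds unfolding scaling_bounds_def Let_def defs by auto
  have low: "- m_\<omega> \<le> a * (M - m_star)" "a * (M - m_star) \<le> M - M_\<omega>"
    using quot(1) signs f_hull by (cases "M = m_star"; simp add: field_simps)+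
  have high: "M_\<omega> - M \<le> a * M_star" "a * M_star \<le> m_\<omega>"
    using quot(2) signs f_hull by (cases "M_star = 0"; simp add: field_simps)+
  note bx = b_range[OF x]
  have "- m_\<omega> \<le> a * (y - b x) \<and> a * (y - b x) \<le> M - M_\<omega>"
  proof (cases "0 \<le> a")
    case True
    have "a * - M_star \<le> a * (y - b x)" "a * (y - b x) \<le> a * (M - m_star)"
      by (rule mult_left_mono; use True y bx in linarith)+
    then show ?thesis using low high by simp
  next
    case False
    have "a * (M - m_star) \<le> a * (y - b x)" "a * (y - b x) \<le> a * - M_star"
      by (rule mult_left_mono_neg; use False y bx in linarith)+
    then show ?thesis using low high by simp
  qed
  then show "0 \<le> f (word_map p \<omega> x) + a * (y - b x)" "f (word_map p \<omega> x) + a * (y - b x) \<le> M"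
    using f_range by auto
qed

lemma sup_norm_uniform_bound:
  assumes "finite W" "compact S" "S \<noteq> {}" "\<And>w. w \<in> W \<Longrightarrow> continuous_on S (g w)"
    and "\<And>w. w \<in> W \<Longrightarrow> sup_norm S (g w) < 1"
  obtains k where "0 \<le> k" "k < 1" "\<And>w x. w \<in> W \<Longrightarrow> x \<in> S \<Longrightarrow> \<bar>g w x\<bar> \<le> k"
proof -
  define k where "k = Max (insert 0 ((\<lambda>w. sup_norm S (g w)) ` W))"
  have "\<bar>g w x\<bar> \<le> k" if "w \<in> W" "x \<in> S" for w x
  proof -
    have "compact ((\<lambda>x. \<bar>g w x\<bar>) ` S)"
      using assms(2,4) that by (intro compact_continuous_image continuous_intros) auto
    then have "bdd_above ((\<lambda>x. \<bar>g w x\<bar>) ` S)"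
      by (intro bounded_imp_bdd_above compact_imp_bounded)
    then have "\<bar>g w x\<bar> \<le> sup_norm S (g w)"
      unfolding sup_norm_def using that(2) by (intro cSUP_upper)
    also have "\<dots> \<le> k"
      unfolding k_def using assms(1) that(1) by (intro Max_ge) auto
    finally show ?thesis .
  qed
  moreover have "0 \<le> k" "k < 1"
    using assms(1,5) by (auto simp: k_def)
  ultimately show thesis using that by blast
qed

theorem theorem4p1:
  fixes p :: "3 \<Rightarrow> real ^ 2" and f b :: "real ^ 2 \<Rightarrow> real"
    and \<alpha> :: "3 list \<Rightarrow> real ^ 2 \<Rightarrow> real" and M :: real and N :: nat
  assumes "equilateral p"
    and "continuous_on (SG p) f"
    and "\<forall>t\<in>SG p. 0 \<le> f t \<and> f t \<le> M"
    and "N \<ge> 1"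
    and "continuous_on (SG p) b"
    and "\<forall>j. b (p j) = f (p j)"
    and "\<forall>\<omega>\<in>words N. continuous_on (SG p) (\<alpha> \<omega>)"
    and "\<forall>\<omega>\<in>words N. sup_norm (SG p) (\<alpha> \<omega>) < 1"
    and "\<forall>\<omega>\<in>words N. \<forall>t\<in>SG p. scaling_bounds p f b M \<omega> (\<alpha> \<omega> t)"
  shows "continuous_on (SG p) (alpha_fractal p N f b \<alpha>) \<and>
    (\<forall>t\<in>SG p. 0 \<le> alpha_fractal p N f b \<alpha> t \<and> alpha_fractal p N f b \<alpha> t \<le> M)"
proof -
  have "words N = {\<omega>. set \<omega> \<subseteq> UNIV \<and> length \<omega> = N}"
    by (simp add: words_def)
  then have fin: "finite (words N)"
    using finite_lists_length_eq[of "UNIV :: 3 set" N] by simp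
  obtain k where k: "0 \<le> k" "k < 1" "\<And>\<omega> x. \<omega> \<in> words N \<Longrightarrow> x \<in> SG p \<Longrightarrow> \<bar>\<alpha> \<omega> x\<bar> \<le> k"
    using sup_norm_uniform_bound[OF fin compact_SG, of p \<alpha>] assms(7,8) vertex_in_SG by blast
  interpret cell_system "SG p" "range p" "words N" "word_map p" f b \<alpha> k
  proof
    show "range p \<subseteq> (\<Union>\<omega>\<in>words N. word_map p \<omega> ` range p)"
    proof clarify
      fix i
      have "p i = word_map p (replicate N i) (p i)" "replicate N i \<in> words N"
        by (simp_all add: word_map_replicate_vertex words_def)
      then show "p i \<in> (\<Union>\<omega>\<in>words N. word_map p \<omega> ` range p)" by blast
    qed
    show "(\<omega> = \<omega>' \<and> x = y) \<or> (x \<in> range p \<and> y \<in> range p)"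
      if "\<omega> \<in> words N" "\<omega>' \<in> words N" "x \<in> SG p" "y \<in> SG p" "word_map p \<omega> x = word_map p \<omega>' y"
      for \<omega> \<omega>' x y
      using word_map_meet[OF assms(1)] that by (simp add: words_def)
    show "SG p = (\<Union>\<omega>\<in>words N. word_map p \<omega> ` SG p)" by (rule SG_words)
  qed (use assms k fin compact_SG vertex_in_SG in
      \<open>auto intro: continuous_on_word_map inj_on_subset[OF inj_word_map]\<close>)
  have fractal_iff: "is_alpha_fractal p N f b \<alpha> g \<longleftrightarrow> g \<in> extensional (SG p) \<and> solution g" for g
    by (auto simp: is_alpha_fractal_def solution_def inv_f_f[OF inj_word_map])
  obtain g0 where g0: "solution g0" by (rule solution_exists)
  define g where "g = restrict g0 (SG p)"
  have g: "solution g"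
    using g0 map_in unfolding solution_def g_def by (simp cong: continuous_on_cong)
  have "alpha_fractal p N f b \<alpha> = g"
    unfolding alpha_fractal_def
  proof (rule the_equality)
    show "is_alpha_fractal p N f b \<alpha> g"
      using g by (simp add: fractal_iff g_def)
    show "h = g" if "is_alpha_fractal p N f b \<alpha> h" for h
    proof (rule extensionalityI)
      show "h \<in> extensional (SG p)" "g \<in> extensional (SG p)"
        using that by (simp_all add: fractal_iff g_def)
      show "h t = g t" if "t \<in> SG p" for t
        using solution_unique[OF _ g that] \<open>is_alpha_fractal p N f b \<alpha> h\<close>
        by (simp add: fractal_iff)
    qed
  qed
  moreover have "continuous_on (SG p) g"
    using g by (simp add: solution_def)
  moreover have "g t \<in> {0..M}" if "t \<in> SG p" for t
  proof (rule solution_in_closed[OF g _ _ _ that])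
    show "{0..M} \<noteq> {}" using assms(3) that by force
    show "f (word_map p \<omega> x) + \<alpha> \<omega> x * (y - b x) \<in> {0..M}"
      if "\<omega> \<in> words N" "x \<in> SG p" "y \<in> {0..M}" for \<omega> x y
      using scaling_bounds_preserve[of p f b M \<omega> "\<alpha> \<omega> x" _ x y] assms that by auto
  qed simp
  ultimately show ?thesis by simp
qed

end
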